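(* Let $P$ be the transition matrix of an ergodic discrete-time Markov chain on the finite state set $\{1,\dots,n\}$, with equilibrium distribution $w$ and Laplacian $\Delta^{ij}=w^i(\delta_{ij}-P_i{}^j)$, and let $L(\phi,\psi)=\sum_{i,j}\phi_i\,\Delta^{ij}\,\psi_j$ for $\phi,\psi\in\mathbb{R}^n$. Fix states $a\neq b$, let $T_{ab}$ be the expected commuting time between $a$ and $b$, and let $$S_{a,b}=\{\phi\in\mathbb{R}^n:\ \phi_a=1,\ \phi_b=0\}.$$ Then $$\frac{1}{T_{ab}}=\min_{\alpha\in S_{a,b}}\ \max_{\substack{\phi,\psi\in S_{a,b}\\ \phi+\psi=2\alpha}}L(\phi,\psi).$$
   Context: The chain has finite state set $\{1,\dots,n\}$ and transition probabilities $P_i{}^j=\mathrm{Prob}(\text{next at } j\mid\text{start at } i)$. Ergodic means that every state can be reached from every other state (irreducibility). The equilibrium distribution $w=(w^i)$ is the unique probability vector with $\sum_i w^iP_i{}^j=w^j$ for all $j$; all $w^i>0$. The chain is not assumed time-reversible, so $\Delta^{ij}$ need not be symmetric and the bilinear form $L$ need not be symmetric. The commuting time $T_{ab}$ is the expected time, starting from $a$, to go to $b$ and then back to $a$; that is, $T_{ab}=M_{ab}+M_{ba}$, where $M_{ab}$ is the expected number of steps for the chain started at $a$ to first hit $b$. *)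

theory Defs
  imports "HOL-Probability.Probability"
begin

text \<open>The state set is a finite type \<open>'n\<close>; \<open>P $ i $ j\<close> is the probability of stepping
  from \<open>i\<close> to \<open>j\<close>.\<close>

definition stochastic :: "real ^ 'n ^ 'n \<Rightarrow> bool" where
  "stochastic P \<longleftrightarrow> (\<forall>i j. 0 \<le> P $ i $ j) \<and> (\<forall>i. (\<Sum>j\<in>UNIV. P $ i $ j) = 1)"

definition ergodic :: "real ^ 'n ^ 'n \<Rightarrow> bool" where
  "ergodic P \<longleftrightarrow> (\<forall>i j. (i, j) \<in> {(k, l). 0 < P $ k $ l}\<^sup>*)"

definition equilibrium :: "real ^ 'n ^ 'n \<Rightarrow> real ^ 'n \<Rightarrow> bool" where
  "equilibrium P w \<longleftrightarrow>
     (\<forall>i. 0 \<le> w $ i) \<and> (\<Sum>i\<in>UNIV. w $ i) = 1 \<and>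
     (\<forall>j. (\<Sum>i\<in>UNIV. w $ i * P $ i $ j) = w $ j)"

definition laplacian :: "real ^ 'n ^ 'n \<Rightarrow> real ^ 'n \<Rightarrow> real ^ 'n ^ 'n" where
  "laplacian P w = (\<chi> i j. w $ i * ((if i = j then 1 else 0) - P $ i $ j))"

definition laplace_form ::
    "real ^ 'n ^ 'n \<Rightarrow> real ^ 'n \<Rightarrow> real ^ 'n \<Rightarrow> real ^ 'n \<Rightarrow> real" where
  "laplace_form P w \<phi> \<psi> = (\<Sum>i\<in>UNIV. \<Sum>j\<in>UNIV. \<phi> $ i * laplacian P w $ i $ j * \<psi> $ j)"

definition potentials :: "'n \<Rightarrow> 'n \<Rightarrow> (real ^ 'n) set" where
  "potentials a b = {\<phi>. \<phi> $ a = 1 \<and> \<phi> $ b = 0}"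

text \<open>\<open>Pr i\<close> is the law under which the process \<open>X\<close> is the chain started at \<open>i\<close>.
  The last clause is the Markov property with one-step transition probabilities \<open>P\<close>,
  with the conditional probability multiplied out.\<close>

definition markov_chain ::
    "real ^ 'n ^ 'n \<Rightarrow> ('n \<Rightarrow> 'w measure) \<Rightarrow> (nat \<Rightarrow> 'w \<Rightarrow> 'n) \<Rightarrow> bool" where
  "markov_chain P Pr X \<longleftrightarrow> (\<forall>i.
     prob_space (Pr i) \<and>
     (\<forall>t. X t \<in> measurable (Pr i) (count_space UNIV)) \<and>
     measure (Pr i) {\<omega> \<in> space (Pr i). X 0 \<omega> = i} = 1 \<and>
     (\<forall>t s. measure (Pr i) {\<omega> \<in> space (Pr i). \<forall>k\<le>Suc t. X k \<omega> = s k} =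
            measure (Pr i) {\<omega> \<in> space (Pr i). \<forall>k\<le>t. X k \<omega> = s k} * P $ s t $ s (Suc t)))"

text \<open>The value is \<open>\<infinity>\<close> if \<open>b\<close> is never visited.\<close>

definition hitting_time :: "(nat \<Rightarrow> 'w \<Rightarrow> 'n) \<Rightarrow> 'n \<Rightarrow> 'w \<Rightarrow> enat" where
  "hitting_time X b \<omega> = (INF t\<in>{t. X t \<omega> = b}. enat t)"

definition mean_hitting_time ::
    "('n \<Rightarrow> 'w measure) \<Rightarrow> (nat \<Rightarrow> 'w \<Rightarrow> 'n) \<Rightarrow> 'n \<Rightarrow> 'n \<Rightarrow> ennreal" where
  "mean_hitting_time Pr X a b = (\<integral>\<^sup>+ \<omega>. ennreal_of_enat (hitting_time X b \<omega>) \<partial>Pr a)"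

definition commuting_time ::
    "('n \<Rightarrow> 'w measure) \<Rightarrow> (nat \<Rightarrow> 'w \<Rightarrow> 'n) \<Rightarrow> 'n \<Rightarrow> 'n \<Rightarrow> ennreal" where
  "commuting_time Pr X a b = mean_hitting_time Pr X a b + mean_hitting_time Pr X b a"

text \<open>Attained extrema.\<close>

definition is_maximum :: "real set \<Rightarrow> real \<Rightarrow> bool" where
  "is_maximum A m \<longleftrightarrow> m \<in> A \<and> (\<forall>x\<in>A. x \<le> m)"

definition is_minimum :: "real set \<Rightarrow> real \<Rightarrow> bool" where
  "is_minimum A m \<longleftrightarrow> m \<in> A \<and> (\<forall>x\<in>A. m \<le> x)"

text \<open>Every stochastic matrix is realised by a chain, so quantifying over all \<open>Pr\<close> and \<open>X\<close>
  with \<open>markov_chain P Pr X\<close> is not vacuous. The realisation iterates independent random maps.\<close>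

primrec iterate_maps :: "'n \<Rightarrow> nat \<Rightarrow> (nat \<Rightarrow> 'n \<Rightarrow> 'n) \<Rightarrow> 'n" where
  "iterate_maps i 0 f = i"
| "iterate_maps i (Suc t) f = f t (iterate_maps i t f)"

lemma iterate_maps_eq_iff:
  "(\<forall>k\<le>t. iterate_maps i k f = s k) \<longleftrightarrow> s 0 = i \<and> (\<forall>k<t. f k (s k) = s (Suc k))"
proof (induction t)
  case (Suc t)
  have "(\<forall>k\<le>Suc t. iterate_maps i k f = s k) \<longleftrightarrow>
      (\<forall>k\<le>t. iterate_maps i k f = s k) \<and> f t (iterate_maps i t f) = s (Suc t)"
    by (auto simp: le_Suc_eq)
  also have "\<dots> \<longleftrightarrow> (\<forall>k\<le>t. iterate_maps i k f = s k) \<and> f t (s t) = s (Suc t)"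
    by auto
  finally show ?case
    using Suc by (auto simp: less_Suc_eq)
qed auto

lemma markov_chain_exists:
  fixes P :: "real ^ 'n ^ 'n"
  assumes "stochastic P"
  shows "\<exists>(Pr :: 'n \<Rightarrow> (nat \<Rightarrow> 'n) measure) X. markov_chain P Pr X"
proof -
  define K where "K i = embed_pmf (\<lambda>j. P $ i $ j)" for i
  have K: "pmf (K i) j = P $ i $ j" for i j
    unfolding K_def
  proof (rule pmf_embed_pmf)
    show "0 \<le> P $ i $ x" for x
      using assms by (simp add: stochastic_def)
    have "(\<Sum>j\<in>UNIV. ennreal (P $ i $ j)) = 1"
      using assms by (simp add: stochastic_def sum_ennreal)
    then show "(\<integral>\<^sup>+ x. ennreal (P $ i $ x) \<partial>count_space UNIV) = 1"
      by (simp add: nn_integral_count_space_finite)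
  qed
  define Q where "Q = measure_pmf (Pi_pmf UNIV undefined K)"
  interpret Q: prob_space Q
    unfolding Q_def by unfold_locales
  interpret product_prob_space "\<lambda>_::nat. Q" UNIV ..
  define M where "M = (\<Pi>\<^sub>M t\<in>(UNIV::nat set). Q)"
  have space_Q: "space Q = UNIV" and sets_Q: "sets Q = UNIV"
    by (simp_all add: Q_def)
  have space_M: "space M = UNIV"
    by (simp add: M_def space_PiM space_Q PiE_def)
  have Q_component: "measure Q {f. f i = j} = P $ i $ j" for i j
  proof -
    have "measure Q {f. f i = j} = measure (map_pmf (\<lambda>f. f i) (Pi_pmf UNIV undefined K)) {j}"
      by (simp add: Q_def measure_map_pmf vimage_def)
    then show ?thesis
      by (simp add: Pi_pmf_component measure_pmf_single K)
  qed
  have cylinder: "measure M {f. \<forall>k<t. f k (s k) = s (Suc k)} = (\<Prod>k<t. P $ s k $ s (Suc k))"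
    for t s
  proof -
    have "{f. \<forall>k<t. f k (s k) = s (Suc k)} =
        prod_emb UNIV (\<lambda>_. Q) {..<t} (\<Pi>\<^sub>E k\<in>{..<t}. {f. f (s k) = s (Suc k)})"
      by (auto simp: prod_emb_def space_Q PiE_def Pi_def extensional_def)
    then show ?thesis
      unfolding M_def
      by (simp add: measure_PiM_emb sets_Q Q_component)
  qed
  have path: "measure M {f. \<forall>k\<le>t. iterate_maps i k f = s k} =
      (if s 0 = i then \<Prod>k<t. P $ s k $ s (Suc k) else 0)" for i t s
    by (simp add: iterate_maps_eq_iff cylinder)
  have Q_meas: "(\<lambda>f. f t) \<in> measurable M (count_space UNIV)" for t
  proof -
    have "(\<lambda>f. f t) \<in> measurable M Q"
      unfolding M_def by measurable
    then show ?thesis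
      using sets_Q by (simp add: measurable_cong_sets[of M M Q "count_space UNIV"])
  qed
  have meas: "iterate_maps i t \<in> measurable M (count_space UNIV)" for i t
  proof (induction t)
    case (Suc t)
    have "(\<lambda>f. f t (iterate_maps i t f)) \<in> measurable M (count_space UNIV)"
      by (rule measurable_compose_countable[OF _ Suc]) (rule measurable_compose[OF Q_meas], simp)
    then show ?case by simp
  qed (simp add: iterate_maps.simps(1)[abs_def])
  define S where "S = (\<Pi>\<^sub>M t\<in>(UNIV::nat set). count_space (UNIV::'n set))"
  define Pr where "Pr i = distr M S (\<lambda>f t. iterate_maps i t f)" for i
  have meas_S: "(\<lambda>f t. iterate_maps i t f) \<in> measurable M S" for i
    unfolding S_def using meas by (intro measurable_PiM_single') auto
  have space_S: "space S = UNIV"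
    by (simp add: S_def space_PiM PiE_def)
  have X_meas: "(\<lambda>x. x t) \<in> measurable S (count_space UNIV)" for t
    unfolding S_def by measurable
  have cyl_sets: "{x. \<forall>k\<le>t. x k = s k} \<in> sets S" for t s
  proof -
    have "{x. x k = s k} \<in> sets S" for k
      using measurable_sets[OF X_meas, of "{s k}" k] by (simp add: vimage_def space_S)
    then have "(\<Inter>k\<in>{..t}. {x. x k = s k}) \<in> sets S"
      by (intro sets.finite_INT) auto
    also have "(\<Inter>k\<in>{..t}. {x. x k = s k}) = {x. \<forall>k\<le>t. x k = s k}"
      by auto
    finally show ?thesis .
  qed
  have law: "measure (Pr i) {x. \<forall>k\<le>t. x k = s k} =
      (if s 0 = i then \<Prod>k<t. P $ s k $ s (Suc k) else 0)" for i t s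
    unfolding Pr_def measure_distr[OF meas_S cyl_sets] space_M using path by simp
  have start: "measure (Pr i) {x. x 0 = i} = 1" for i
    using law[of i 0 "\<lambda>_. i"] by simp
  have prob: "prob_space (Pr i)" for i
    unfolding Pr_def M_def
    by (rule prob_space.prob_space_distr[OF prob_space_axioms meas_S[unfolded M_def]])
  have space_Pr: "space (Pr i) = UNIV" and meas_Pr: "(\<lambda>x. x t) \<in> measurable (Pr i) (count_space UNIV)"
    for i t
    using X_meas by (simp_all add: Pr_def space_S)
  have "markov_chain P Pr (\<lambda>t x. x t)"
    unfolding markov_chain_def using prob meas_Pr start by (simp add: space_Pr law)
  then show ?thesis
    by blast
qed

end

theory Submission
  imports Defs
begin

text \<open>The form \<open>L(x, x)\<close> is half the sum of \<open>w\<^sub>i P\<^sub>i\<^sub>j (x\<^sub>i - x\<^sub>j)\<^sup>2\<close>, hence positive definite on the functions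
  vanishing at \<open>a\<close> and \<open>b\<close>. Let \<open>\<phi>\<close> and \<open>\<psi>\<close> be the potentials that are harmonic off \<open>a, b\<close> for the
  transposed Laplacian and for the Laplacian itself. The minimum is attained at
  \<open>\<alpha> = (\<phi> + \<psi>) / 2\<close> and its value is \<open>L(\<phi>, \<psi>)\<close>. If \<open>h\<close> and \<open>k\<close> are the mean hitting times of \<open>b\<close>
  and \<open>a\<close>, then \<open>\<Delta> h = w - e\<^sub>b\<close> and \<open>\<Delta> k = w - e\<^sub>a\<close>, so \<open>\<psi>\<close> equals \<open>(h - k + k\<^sub>b) / T\<close>, where
  \<open>T = h\<^sub>a + k\<^sub>b\<close> is the commuting time, and \<open>L(\<phi>, \<psi>) = 1 / T\<close>.\<close>

section \<open>The Laplacian form\<close>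

lemma laplacian_mult_nth:
  "(laplacian P w *v x) $ i = w $ i * (x $ i - (\<Sum>j\<in>UNIV. P $ i $ j * x $ j))"
proof -
  have "(laplacian P w *v x) $ i =
      (\<Sum>j\<in>UNIV. w $ i * (if i = j then x $ j else 0) - w $ i * (P $ i $ j * x $ j))"
    unfolding matrix_vector_mult_def by (auto simp: laplacian_def algebra_simps intro!: sum.cong)
  then show ?thesis
    by (simp add: sum_subtractf sum_distrib_left[symmetric] right_diff_distrib)
qed

lemma laplace_form_inner: "laplace_form P w \<phi> \<psi> = \<phi> \<bullet> (laplacian P w *v \<psi>)"
  by (simp add: laplace_form_def inner_vec_def matrix_vector_mult_def sum_distrib_left mult.assoc)

lemma equilibrium_sum_step:
  assumes "equilibrium P w"
  shows "(\<Sum>i\<in>UNIV. w $ i * (\<Sum>j\<in>UNIV. P $ i $ j * f j)) = (\<Sum>j\<in>UNIV. w $ j * f j)"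
proof -
  have "(\<Sum>i\<in>UNIV. w $ i * (\<Sum>j\<in>UNIV. P $ i $ j * f j)) =
      (\<Sum>j\<in>UNIV. \<Sum>i\<in>UNIV. w $ i * P $ i $ j * f j)"
    by (subst sum.swap) (simp add: sum_distrib_left mult.assoc)
  also have "\<dots> = (\<Sum>j\<in>UNIV. w $ j * f j)"
    using assms by (simp add: equilibrium_def sum_distrib_right[symmetric])
  finally show ?thesis .
qed

text \<open>Stationarity makes every column of the Laplacian sum to zero. This later determines the
  one entry that a hitting equation leaves open.\<close>

lemma sum_laplacian_mult:
  assumes "equilibrium P w"
  shows "(\<Sum>i\<in>UNIV. (laplacian P w *v x) $ i) = 0"
  using equilibrium_sum_step[OF assms, of "\<lambda>j. x $ j"]
  by (simp add: laplacian_mult_nth right_diff_distrib sum_subtractf)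

text \<open>Expand the square: row sums equal to one handle the first term and stationarity turns
  the last into the same sum, so only the cross term distinguishes the two sides.\<close>

lemma laplace_form_energy:
  assumes "stochastic P" and "equilibrium P w"
  shows "laplace_form P w x x =
    (\<Sum>i\<in>UNIV. w $ i * (\<Sum>j\<in>UNIV. P $ i $ j * (x $ i - x $ j)\<^sup>2)) / 2"
proof -
  have row: "(\<Sum>j\<in>UNIV. P $ i $ j) = 1" for i
    using assms(1) by (simp add: stochastic_def)
  have inner: "(\<Sum>j\<in>UNIV. P $ i $ j * (x $ i - x $ j)\<^sup>2) =
      (x $ i)\<^sup>2 - 2 * x $ i * (\<Sum>j\<in>UNIV. P $ i $ j * x $ j) + (\<Sum>j\<in>UNIV. P $ i $ j * (x $ j)\<^sup>2)"
    for i
  proof -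
    have "(\<Sum>j\<in>UNIV. P $ i $ j * (x $ i - x $ j)\<^sup>2) =
      (\<Sum>j\<in>UNIV. P $ i $ j * (x $ i)\<^sup>2 - 2 * x $ i * (P $ i $ j * x $ j) + P $ i $ j * (x $ j)\<^sup>2)"
      by (rule sum.cong) (auto simp: power2_eq_square algebra_simps)
    then show ?thesis
      by (simp add: sum.distrib sum_subtractf sum_distrib_left[symmetric] sum_distrib_right[symmetric] row)
  qed
  have "(\<Sum>i\<in>UNIV. w $ i * (\<Sum>j\<in>UNIV. P $ i $ j * (x $ i - x $ j)\<^sup>2)) =
      (\<Sum>i\<in>UNIV. (w $ i * (x $ i)\<^sup>2 - 2 * (x $ i * (w $ i * (\<Sum>j\<in>UNIV. P $ i $ j * x $ j)))) +
        w $ i * (\<Sum>j\<in>UNIV. P $ i $ j * (x $ j)\<^sup>2))"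
    unfolding inner by (rule sum.cong) (auto simp: algebra_simps)
  also have "\<dots> = 2 * (\<Sum>i\<in>UNIV. w $ i * (x $ i)\<^sup>2) -
      2 * (\<Sum>i\<in>UNIV. x $ i * (w $ i * (\<Sum>j\<in>UNIV. P $ i $ j * x $ j)))"
    using equilibrium_sum_step[OF assms(2), of "\<lambda>j. (x $ j)\<^sup>2"]
    by (simp add: sum.distrib sum_subtractf sum_distrib_left[symmetric])
  also have "\<dots> = 2 * laplace_form P w x x"
    by (simp add: laplace_form_inner inner_vec_def laplacian_mult_nth right_diff_distrib
        sum_subtractf power2_eq_square mult.left_commute)
  finally show ?thesis by simp
qed

lemma ergodic_propagate:
  assumes "ergodic P" and "Q i" and "\<And>k l. \<lbrakk>Q k; 0 < P $ k $ l\<rbrakk> \<Longrightarrow> Q l"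
  shows "Q j"
proof -
  have "(i, j) \<in> {(k, l). 0 < P $ k $ l}\<^sup>*"
    using assms(1) by (simp add: ergodic_def)
  then show ?thesis
    by induction (use assms(2,3) in auto)
qed

text \<open>Some entry is positive because the total is one, and stationarity carries positivity
  along every transition of positive probability.\<close>

lemma equilibrium_pos:
  assumes "stochastic P" and "ergodic P" and "equilibrium P w"
  shows "0 < w $ i"
proof -
  have w: "\<And>i. 0 \<le> w $ i" "(\<Sum>i\<in>UNIV. w $ i) = 1" "\<And>j. (\<Sum>i\<in>UNIV. w $ i * P $ i $ j) = w $ j"
    and P: "\<And>i j. 0 \<le> P $ i $ j"
    using assms by (auto simp: equilibrium_def stochastic_def)
  obtain k where "w $ k \<noteq> 0"
    using w(2) by (metis sum.neutral zero_neq_one)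
  then have "0 < w $ k"
    using w(1)[of k] by simp
  then show ?thesis
  proof (rule ergodic_propagate[OF assms(2)])
    fix k l assume "0 < w $ k" "0 < P $ k $ l"
    then have "0 < w $ k * P $ k $ l" by simp
    also have "\<dots> \<le> (\<Sum>i\<in>UNIV. w $ i * P $ i $ l)"
      using w(1) P by (intro member_le_sum) auto
    finally show "0 < w $ l" by (simp add: w(3))
  qed
qed

text \<open>Zero energy forces \<open>x\<close> to agree across every possible transition, so the
  zero at \<open>b\<close> spreads to all states by irreducibility.\<close>

lemma laplace_form_pos:
  assumes "stochastic P" and "ergodic P" and "equilibrium P w" and "x $ b = 0" and "x \<noteq> 0"
  shows "0 < laplace_form P w x x"
proof -
  have P: "\<And>i j. 0 \<le> P $ i $ j"
    using assms(1) by (auto simp: stochastic_def)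
  note w = equilibrium_pos[OF assms(1-3)]
  let ?e = "\<lambda>i. w $ i * (\<Sum>j\<in>UNIV. P $ i $ j * (x $ i - x $ j)\<^sup>2)"
  have e: "0 \<le> ?e i" for i
    using P less_imp_le[OF w] by (intro mult_nonneg_nonneg sum_nonneg) auto
  have "0 \<le> laplace_form P w x x"
    unfolding laplace_form_energy[OF assms(1,3)] using e by (simp add: sum_nonneg)
  moreover have "laplace_form P w x x \<noteq> 0"
  proof
    assume "laplace_form P w x x = 0"
    then have "(\<Sum>i\<in>UNIV. ?e i) = 0"
      unfolding laplace_form_energy[OF assms(1,3)] by simp
    then have "?e i = 0" for i
      using e by (subst (asm) sum_nonneg_eq_0_iff) auto
    then have "(\<Sum>j\<in>UNIV. P $ i $ j * (x $ i - x $ j)\<^sup>2) = 0" for i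
      using w[of i] by (metis (no_types, lifting) less_irrefl mult_eq_0_iff)
    then have *: "P $ i $ j * (x $ i - x $ j)\<^sup>2 = 0" for i j
      using P by (subst (asm) sum_nonneg_eq_0_iff) auto
    have "x $ j = 0" for j
    proof (rule ergodic_propagate[OF assms(2), of "\<lambda>j. x $ j = 0", OF assms(4)])
      fix k l assume "x $ k = 0" "0 < P $ k $ l"
      then show "x $ l = 0" using *[of k l] by simp
    qed
    then have "x = 0" by (simp add: vec_eq_iff)
    with assms(5) show False by simp
  qed
  ultimately show ?thesis by simp
qed

section \<open>Boundary value problems and the minimax\<close>

lemma inner_eq_0_supportI:
  fixes x y :: "real ^ 'n"
  assumes "\<And>i. x $ i = 0 \<or> y $ i = 0"
  shows "x \<bullet> y = 0"
  unfolding inner_vec_def by (rule sum.neutral) (use assms in auto)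

text \<open>The linear map that keeps the entries on \<open>A\<close> and applies \<open>B\<close>
  elsewhere is injective: for a kernel vector, \<open>x\<close> and \<open>B *v x\<close> have
  disjoint supports, so the hypothesis applies. Finite dimension gives surjectivity.\<close>

lemma boundary_value_problem:
  fixes B :: "real ^ 'n ^ 'n" and A :: "'n set"
  assumes "\<And>x. \<lbrakk>\<And>i. i \<in> A \<Longrightarrow> x $ i = 0; x \<bullet> (B *v x) = 0\<rbrakk> \<Longrightarrow> x = 0"
  obtains x where "\<And>i. i \<in> A \<Longrightarrow> x $ i = r $ i" and "\<And>i. i \<notin> A \<Longrightarrow> (B *v x) $ i = r $ i"
proof -
  define f where "f x = (\<chi> i. if i \<in> A then x $ i else (B *v x) $ i)" for x
  have "linear f"
    by (rule linearI)
      (auto simp: f_def vec_eq_iff matrix_vector_right_distrib matrix_vector_mult_scaleR)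
  moreover have "x = 0" if "f x = 0" for x
  proof (rule assms)
    have *: "(if i \<in> A then x $ i else (B *v x) $ i) = 0" for i
      using that by (simp add: f_def vec_eq_iff)
    then show "x $ i = 0" if "i \<in> A" for i
      using that by metis
    have "x $ i = 0 \<or> (B *v x) $ i = 0" for i
      using *[of i] by (auto split: if_splits)
    then show "x \<bullet> (B *v x) = 0"
      by (rule inner_eq_0_supportI)
  qed
  ultimately have "surj f"
    by (intro linear_injective_imp_surjective) (auto simp: linear_injective_0)
  then obtain x where "f x = r" by (metis surjD)
  then have "(if i \<in> A then x $ i else (B *v x) $ i) = r $ i" for i
    by (auto simp: f_def)
  then show thesis
    by (metis that)
qed

lemma potentials_diff:
  "\<lbrakk>\<phi> \<in> potentials a b; \<psi> \<in> potentials a b; i = a \<or> i = b\<rbrakk> \<Longrightarrow> (\<phi> - \<psi>) $ i = 0"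
  by (auto simp: potentials_def)

lemma potentials_add:
  "\<lbrakk>\<phi> \<in> potentials a b; \<eta> $ a = 0; \<eta> $ b = 0\<rbrakk> \<Longrightarrow> \<phi> + \<eta> \<in> potentials a b \<and> \<phi> - \<eta> \<in> potentials a b"
  by (auto simp: potentials_def)

lemma inner_transpose_mult:
  fixes D :: "real ^ 'n ^ 'n"
  shows "x \<bullet> (transpose D *v y) = y \<bullet> (D *v x)"
  by (simp add: dot_lmul_matrix[symmetric] inner_commute)

text \<open>The competitors of the inner maximum, for a general matrix: the minimax argument uses
  only positivity of the form.\<close>

definition splittings :: "real ^ 'n ^ 'n \<Rightarrow> 'n \<Rightarrow> 'n \<Rightarrow> real ^ 'n \<Rightarrow> real set" where
  "splittings D a b \<alpha> = {\<phi> \<bullet> (D *v \<psi>) |\<phi> \<psi>.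
     \<phi> \<in> potentials a b \<and> \<psi> \<in> potentials a b \<and> \<phi> + \<psi> = 2 *\<^sub>R \<alpha>}"

text \<open>Splitting \<open>2 \<alpha>\<close> as \<open>(\<alpha> + \<eta>) + (\<alpha> - \<eta>)\<close> makes the form a strictly concave quadratic in \<open>\<eta>\<close>;
  its critical point solves a boundary value problem for \<open>D + D\<^sup>T\<close>.\<close>

lemma splittings_maximum:
  fixes D :: "real ^ 'n ^ 'n"
  assumes pos: "\<And>x. \<lbrakk>x $ a = 0; x $ b = 0; x \<noteq> 0\<rbrakk> \<Longrightarrow> 0 < x \<bullet> (D *v x)"
    and \<alpha>: "\<alpha> \<in> potentials a b"
  shows "\<exists>m. is_maximum (splittings D a b \<alpha>) m"
proof -
  \<comment> \<open>Zero on the boundary keeps \<alpha> + \<eta> and \<alpha> - \<eta> admissible;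
    the interior values come from setting the gradient in \<eta> to zero.\<close>
  let ?r = "(\<chi> i. if i \<in> {a, b} then 0 else (D *v \<alpha> - transpose D *v \<alpha>) $ i)"
  obtain \<eta> where \<eta>: "\<And>i. i \<in> {a, b} \<Longrightarrow> \<eta> $ i = ?r $ i"
      "\<And>i. i \<notin> {a, b} \<Longrightarrow> ((D + transpose D) *v \<eta>) $ i = ?r $ i"
  proof (rule boundary_value_problem[of "{a, b}" "D + transpose D" ?r])
    fix x :: "real ^ 'n"
    assume x: "\<And>i. i \<in> {a, b} \<Longrightarrow> x $ i = 0" "x \<bullet> ((D + transpose D) *v x) = 0"
    then have "x \<bullet> (D *v x) = 0"
      by (simp add: matrix_vector_mult_add_rdistrib inner_add_right inner_transpose_mult
          del: transpose_matrix_vector)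
    then show "x = 0" using pos[of x] x(1) by force
  qed (blast intro: that)
  have \<eta>0: "\<eta> $ a = 0" "\<eta> $ b = 0"
    using \<eta>(1) by auto
  \<comment> \<open>The first-order condition: the derivative at \<eta> in each admissible direction
    \<zeta> vanishes.\<close>
  have crit: "\<zeta> \<bullet> (D *v (\<alpha> - \<eta>)) = (\<alpha> + \<eta>) \<bullet> (D *v \<zeta>)" if "\<zeta> $ a = 0" "\<zeta> $ b = 0" for \<zeta>
  proof -
    have "\<zeta> \<bullet> ((D + transpose D) *v \<eta> - (D *v \<alpha> - transpose D *v \<alpha>)) = 0"
    proof (rule inner_eq_0_supportI)
      fix i
      show "\<zeta> $ i = 0 \<or> ((D + transpose D) *v \<eta> - (D *v \<alpha> - transpose D *v \<alpha>)) $ i = 0"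
        using \<eta>(2)[of i] that by (cases "i \<in> {a, b}") auto
    qed
    then show ?thesis
      by (simp add: matrix_vector_mult_add_rdistrib inner_add_right inner_diff_right
          inner_transpose_mult matrix_vector_mult_diff_distrib inner_add_left
          del: transpose_matrix_vector)
  qed
  have "is_maximum (splittings D a b \<alpha>) ((\<alpha> + \<eta>) \<bullet> (D *v (\<alpha> - \<eta>)))"
    unfolding is_maximum_def
  proof (intro conjI ballI)
    show "(\<alpha> + \<eta>) \<bullet> (D *v (\<alpha> - \<eta>)) \<in> splittings D a b \<alpha>"
    proof -
      have "(\<alpha> + \<eta>) + (\<alpha> - \<eta>) = 2 *\<^sub>R \<alpha>"
        by (simp add: scaleR_2)
      then show ?thesis
        unfolding splittings_def using potentials_add[OF \<alpha> \<eta>0] by blast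
    qed
    fix v assume "v \<in> splittings D a b \<alpha>"
    then obtain \<phi> \<psi> where *: "v = \<phi> \<bullet> (D *v \<psi>)" "\<phi> \<in> potentials a b" "\<phi> + \<psi> = 2 *\<^sub>R \<alpha>"
      unfolding splittings_def by blast
    define \<zeta> where "\<zeta> = \<phi> - (\<alpha> + \<eta>)"
    have \<zeta>: "\<zeta> $ a = 0" "\<zeta> $ b = 0"
      using potentials_diff[OF *(2) conjunct1[OF potentials_add[OF \<alpha> \<eta>0]]] unfolding \<zeta>_def by auto
    have \<phi>: "\<phi> = (\<alpha> + \<eta>) + \<zeta>" and \<psi>: "\<psi> = (\<alpha> - \<eta>) - \<zeta>"
      using *(3) by (auto simp: \<zeta>_def scaleR_2 algebra_simps)
    \<comment> \<open>The terms linear in \<zeta> cancel by \<open>crit\<close>; only the negative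
      quadratic term remains.\<close>
    have "v = (\<alpha> + \<eta>) \<bullet> (D *v (\<alpha> - \<eta>)) - \<zeta> \<bullet> (D *v \<zeta>)"
      using crit[OF \<zeta>] unfolding *(1) \<phi> \<psi> inner_add_left[of _ \<zeta>] matrix_vector_mult_diff_distrib[of D _ \<zeta>]
      by (simp add: inner_diff_right)
    moreover have "0 \<le> \<zeta> \<bullet> (D *v \<zeta>)"
      using pos[OF \<zeta>] by (cases "\<zeta> = 0") auto
    ultimately show "v \<le> (\<alpha> + \<eta>) \<bullet> (D *v (\<alpha> - \<eta>))" by simp
  qed
  then show ?thesis by blast
qed

text \<open>The saddle point is built from \<open>\<psi>\<close> and its counterpart \<open>\<phi>\<close> for \<open>D\<^sup>T\<close>: with
  \<open>2 \<alpha> = (\<phi> + \<beta>) + (\<psi> + \<beta>)\<close>, the cross terms vanish and this splitting has value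
  \<open>c + \<beta> \<bullet> D \<beta> \<ge> c\<close>.\<close>

lemma splittings_minimax:
  fixes D :: "real ^ 'n ^ 'n"
  assumes pos: "\<And>x. \<lbrakk>x $ a = 0; x $ b = 0; x \<noteq> 0\<rbrakk> \<Longrightarrow> 0 < x \<bullet> (D *v x)"
    and "a \<noteq> b" and \<psi>: "\<psi> \<in> potentials a b"
    and val: "\<And>\<phi>. \<phi> \<in> potentials a b \<Longrightarrow> \<phi> \<bullet> (D *v \<psi>) = c"
  shows "\<exists>F. (\<forall>\<alpha>\<in>potentials a b. is_maximum (splittings D a b \<alpha>) (F \<alpha>)) \<and>
    is_minimum (F ` potentials a b) c"
proof -
  obtain F where F: "\<And>\<alpha>. \<alpha> \<in> potentials a b \<Longrightarrow> is_maximum (splittings D a b \<alpha>) (F \<alpha>)"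
    using splittings_maximum[OF pos] by metis
  let ?r = "(\<chi> i. if i = a then 1 else 0) :: real ^ 'n"
  obtain \<phi> where \<phi>': "\<And>i. i \<in> {a, b} \<Longrightarrow> \<phi> $ i = ?r $ i"
      "\<And>i. i \<notin> {a, b} \<Longrightarrow> (transpose D *v \<phi>) $ i = ?r $ i"
  proof (rule boundary_value_problem[of "{a, b}" "transpose D" ?r])
    fix x :: "real ^ 'n"
    assume x: "\<And>i. i \<in> {a, b} \<Longrightarrow> x $ i = 0" "x \<bullet> (transpose D *v x) = 0"
    then have "x \<bullet> (D *v x) = 0"
      by (simp add: inner_transpose_mult del: transpose_matrix_vector)
    then show "x = 0" using pos[of x] x(1) by force
  qed (blast intro: that)
  have \<phi>: "\<phi> \<in> potentials a b"
    using \<phi>'(1) \<open>a \<noteq> b\<close> by (auto simp: potentials_def)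
  have \<phi>0: "\<phi> \<bullet> (D *v \<zeta>) = 0" if "\<zeta> $ a = 0" "\<zeta> $ b = 0" for \<zeta>
  proof -
    have "\<zeta> \<bullet> (transpose D *v \<phi>) = 0"
    proof (rule inner_eq_0_supportI)
      show "\<zeta> $ i = 0 \<or> (transpose D *v \<phi>) $ i = 0" for i
        using \<phi>'(2)[of i] that by (cases "i \<in> {a, b}") auto
    qed
    then show ?thesis
      by (simp only: inner_transpose_mult)
  qed
  \<comment> \<open>Moving \<psi> by \<zeta> stays among the potentials, where the pairing is
    constant, so \<zeta> contributes nothing.\<close>
  have \<psi>0: "\<zeta> \<bullet> (D *v \<psi>) = 0" if "\<zeta> $ a = 0" "\<zeta> $ b = 0" for \<zeta>
    using val[OF \<psi>] val[OF conjunct1[OF potentials_add[OF \<psi> that]]] by (simp add: inner_add_left)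
  have nonneg: "0 \<le> x \<bullet> (D *v x)" if "x $ a = 0" "x $ b = 0" for x
    using pos[OF that] by (cases "x = 0") auto
  have lower: "c \<le> F \<alpha>" if \<alpha>: "\<alpha> \<in> potentials a b" for \<alpha>
  proof -
    define \<beta> where "\<beta> = \<alpha> - (1/2) *\<^sub>R (\<phi> + \<psi>)"
    have \<beta>: "\<beta> $ a = 0" "\<beta> $ b = 0"
      using \<alpha> \<phi> \<psi> by (auto simp: \<beta>_def potentials_def)
    have "(\<phi> + \<beta>) + (\<psi> + \<beta>) = 2 *\<^sub>R \<alpha>"
      by (simp add: \<beta>_def vec_eq_iff field_simps)
    then have "(\<phi> + \<beta>) \<bullet> (D *v (\<psi> + \<beta>)) \<in> splittings D a b \<alpha>"
      unfolding splittings_def using potentials_add[OF \<phi> \<beta>] potentials_add[OF \<psi> \<beta>] by blast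
    then have "(\<phi> + \<beta>) \<bullet> (D *v (\<psi> + \<beta>)) \<le> F \<alpha>"
      using F[OF \<alpha>] by (simp add: is_maximum_def)
    moreover have "(\<phi> + \<beta>) \<bullet> (D *v (\<psi> + \<beta>)) = c + \<beta> \<bullet> (D *v \<beta>)"
      using val[OF \<phi>] \<phi>0[OF \<beta>] \<psi>0[OF \<beta>]
      by (simp add: inner_add_left inner_add_right matrix_vector_right_distrib)
    ultimately show ?thesis
      using nonneg[OF \<beta>] by simp
  qed
  \<comment> \<open>At this midpoint every splitting is \<phi> + \<zeta>, \<psi> - \<zeta> with
    \<zeta> zero at \<open>a\<close> and \<open>b\<close>, so the lower bound \<open>c\<close> is
    attained.\<close>
  define \<alpha> where "\<alpha> = (1/2) *\<^sub>R (\<phi> + \<psi>)"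
  have \<alpha>: "\<alpha> \<in> potentials a b"
    using \<phi> \<psi> by (auto simp: \<alpha>_def potentials_def)
  have "v \<le> c" if v: "v \<in> splittings D a b \<alpha>" for v
  proof -
    obtain \<phi>1 \<psi>1 where *: "v = \<phi>1 \<bullet> (D *v \<psi>1)" "\<phi>1 \<in> potentials a b" "\<phi>1 + \<psi>1 = 2 *\<^sub>R \<alpha>"
      using v unfolding splittings_def by blast
    define \<zeta> where "\<zeta> = \<phi>1 - \<phi>"
    have \<zeta>: "\<zeta> $ a = 0" "\<zeta> $ b = 0"
      using potentials_diff[OF *(2) \<phi>] unfolding \<zeta>_def by auto
    have eqs: "\<phi>1 = \<phi> + \<zeta>" "\<psi>1 = \<psi> - \<zeta>"
      using *(3) by (auto simp: \<zeta>_def \<alpha>_def algebra_simps)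
    have "v = c - \<zeta> \<bullet> (D *v \<zeta>)"
      unfolding *(1) eqs using val[OF \<phi>] \<phi>0[OF \<zeta>] \<psi>0[OF \<zeta>]
      by (simp add: inner_add_left inner_diff_right matrix_vector_mult_diff_distrib)
    then show ?thesis
      using nonneg[OF \<zeta>] by simp
  qed
  then have "F \<alpha> = c"
    using F[OF \<alpha>] lower[OF \<alpha>] by (simp add: is_maximum_def order.antisym)
  then have "is_minimum (F ` potentials a b) c"
    using lower \<alpha> by (auto simp: is_minimum_def)
  then show ?thesis
    using F by blast
qed

section \<open>Mean hitting times\<close>

text \<open>The probability that the chain from \<open>i\<close> avoids \<open>b\<close> at all
  times from 0 through \<open>t\<close>, by conditioning on the first step;
  \<open>prob_avoid\<close> confirms this.\<close>

primrec survival :: "real ^ 'n ^ 'n \<Rightarrow> 'n \<Rightarrow> nat \<Rightarrow> 'n \<Rightarrow> real" where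
  "survival P b 0 i = (if i = b then 0 else 1)"
| "survival P b (Suc t) i = (if i = b then 0 else \<Sum>j\<in>UNIV. P $ i $ j * survival P b t j)"

lemma survival_nonneg: "stochastic P \<Longrightarrow> 0 \<le> survival P b t i"
  by (induction t arbitrary: i) (auto simp: stochastic_def intro!: sum_nonneg)

lemma survival_target [simp]: "survival P b t b = 0"
  by (cases t) auto

text \<open>The prefix \<open>s\<close> is arbitrary so that the recursion of \<^const>\<open>survival\<close>, which conditions on the
  first step, matches the Markov property, which extends a path at its end.\<close>

lemma measure_prefix_avoid:
  assumes "markov_chain P Pr X"
  shows "measure (Pr i) {\<omega> \<in> space (Pr i). (\<forall>k\<le>m. X k \<omega> = s k) \<and> (\<forall>k\<in>{m..m + t}. X k \<omega> \<noteq> b)} =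
    measure (Pr i) {\<omega> \<in> space (Pr i). \<forall>k\<le>m. X k \<omega> = s k} * survival P b t (s m)"
proof -
  interpret prob_space "Pr i"
    using assms by (simp add: markov_chain_def)
  have X [measurable]: "X t \<in> measurable (Pr i) (count_space UNIV)" for t
    using assms by (simp add: markov_chain_def)
  have markov: "prob {\<omega> \<in> space (Pr i). \<forall>k\<le>Suc t. X k \<omega> = s k} =
      prob {\<omega> \<in> space (Pr i). \<forall>k\<le>t. X k \<omega> = s k} * P $ s t $ s (Suc t)" for t s
    using assms by (simp add: markov_chain_def)
  show ?thesis
  proof (induction t arbitrary: m s)
    case 0
    have "{\<omega> \<in> space (Pr i). (\<forall>k\<le>m. X k \<omega> = s k) \<and> (\<forall>k\<in>{m..m + 0}. X k \<omega> \<noteq> b)} =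
      (if s m = b then {} else {\<omega> \<in> space (Pr i). \<forall>k\<le>m. X k \<omega> = s k})"
      by auto
    then show ?case by auto
  next
    case (Suc t)
    show ?case
    proof (cases "s m = b")
      case True
      then have "{\<omega> \<in> space (Pr i). (\<forall>k\<le>m. X k \<omega> = s k) \<and> (\<forall>k\<in>{m..m + Suc t}. X k \<omega> \<noteq> b)} = {}"
        by force
      then show ?thesis using True by (simp only: measure_empty survival_target mult_zero_right)
    next
      case False
      \<comment> \<open>Partition by the state \<open>j\<close> at time \<open>Suc m\<close>,
        extending the prefix by one entry so that the induction hypothesis applies.\<close>
      let ?s = "\<lambda>j. s(Suc m := j)"
      let ?E = "\<lambda>j. {\<omega> \<in> space (Pr i). (\<forall>k\<le>Suc m. X k \<omega> = ?s j k) \<and>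
        (\<forall>k\<in>{Suc m..Suc m + t}. X k \<omega> \<noteq> b)}"
      have split: "(\<forall>k\<le>Suc m. X k \<omega> = ?s j k) \<longleftrightarrow> (\<forall>k\<le>m. X k \<omega> = s k) \<and> X (Suc m) \<omega> = j" for j \<omega>
        by (auto simp: le_Suc_eq)
      have ivl: "{m..m + Suc t} = insert m {Suc m..Suc m + t}"
        by auto
      have "{\<omega> \<in> space (Pr i). (\<forall>k\<le>m. X k \<omega> = s k) \<and> (\<forall>k\<in>{m..m + Suc t}. X k \<omega> \<noteq> b)} = (\<Union>j. ?E j)"
        unfolding split ivl using False by auto
      moreover have "prob (\<Union>j. ?E j) = (\<Sum>j\<in>UNIV. prob (?E j))"
      proof (rule finite_measure_finite_Union)
        show "?E ` UNIV \<subseteq> events" by auto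
        show "disjoint_family ?E"
          unfolding disjoint_family_on_def split by auto
      qed simp
      moreover have "prob (?E j) =
          prob {\<omega> \<in> space (Pr i). \<forall>k\<le>m. X k \<omega> = s k} * (P $ s m $ j * survival P b t j)" for j
        unfolding Suc.IH markov by (auto intro!: arg_cong[where f = prob])
      ultimately show ?thesis
        using False by (simp add: sum_distrib_left)
    qed
  qed
qed

lemma prob_avoid:
  assumes "markov_chain P Pr X"
  shows "measure (Pr i) {\<omega> \<in> space (Pr i). \<forall>k\<le>t. X k \<omega> \<noteq> b} = survival P b t i"
proof -
  interpret prob_space "Pr i"
    using assms by (simp add: markov_chain_def)
  have X [measurable]: "X t \<in> measurable (Pr i) (count_space UNIV)" for t
    using assms by (simp add: markov_chain_def)
  have start: "prob {\<omega> \<in> space (Pr i). X 0 \<omega> = i} = 1"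
    using assms by (simp add: markov_chain_def)
  then have "AE \<omega> in Pr i. X 0 \<omega> = i"
    by (subst (asm) prob_Collect_eq_1) auto
  then have "prob {\<omega> \<in> space (Pr i). \<forall>k\<le>t. X k \<omega> \<noteq> b} =
      prob {\<omega> \<in> space (Pr i). (\<forall>k\<le>0. X k \<omega> = i) \<and> (\<forall>k\<in>{0..0 + t}. X k \<omega> \<noteq> b)}"
    by (intro finite_measure_eq_AE) (auto elim!: eventually_mono)
  also have "\<dots> = survival P b t i"
    unfolding measure_prefix_avoid[OF assms] using start by simp
  finally show ?thesis .
qed

text \<open>Reduces the infimum to finitely many times; both measurability and the tail-sum formula
  rest on this.\<close>

lemma less_hitting_time_iff: "enat t < hitting_time X b \<omega> \<longleftrightarrow> (\<forall>k\<le>t. X k \<omega> \<noteq> b)"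
proof
  assume *: "enat t < hitting_time X b \<omega>"
  show "\<forall>k\<le>t. X k \<omega> \<noteq> b"
  proof (intro allI impI notI)
    fix k assume "k \<le> t" "X k \<omega> = b"
    then have "hitting_time X b \<omega> \<le> enat k"
      unfolding hitting_time_def by (intro INF_lower) auto
    with * \<open>k \<le> t\<close> show False
      by (metis enat_ord_simps(1) leD order_trans)
  qed
next
  assume *: "\<forall>k\<le>t. X k \<omega> \<noteq> b"
  have "enat (Suc t) \<le> hitting_time X b \<omega>"
    unfolding hitting_time_def by (rule INF_greatest) (use * in \<open>auto simp: not_less_eq_eq[symmetric]\<close>)
  then show "enat t < hitting_time X b \<omega>"
    by (metis Suc_ile_eq)
qed

text \<open>The values are countable, and each level set is a countable Boolean combination of tail
  events.\<close>

lemma hitting_time_measurable: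
  assumes X [measurable]: "\<And>t. X t \<in> measurable M (count_space UNIV)"
  shows "hitting_time X b \<in> measurable M (count_space UNIV)"
proof -
  have lt: "Measurable.pred M (\<lambda>\<omega>. enat t < hitting_time X b \<omega>)" for t
    unfolding less_hitting_time_iff by measurable
  have "Measurable.pred M (\<lambda>\<omega>. hitting_time X b \<omega> = e)" for e
  proof (cases e)
    case (enat n)
    have "e' = enat n \<longleftrightarrow> \<not> enat n < e' \<and> (\<forall>k<n. enat k < e')" for e'
      by (cases e') (auto simp: not_less order.order_iff_strict)
    then show ?thesis
      unfolding enat using lt by simp
  next
    case infinity
    have "e' = \<infinity> \<longleftrightarrow> (\<forall>k. enat k < e')" for e'
      by (cases e') auto
    then show ?thesis
      unfolding infinity using lt by simp
  qed
  then show ?thesis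
    by (subst measurable_count_space_eq2_countable) (auto simp: pred_def vimage_def Int_def conj_commute)
qed

text \<open>The expectation of an extended natural number is the sum of its tail
  probabilities.\<close>

lemma mean_hitting_time_survival:
  assumes "markov_chain P Pr X"
  shows "mean_hitting_time Pr X i b = (\<Sum>t. ennreal (survival P b t i))"
proof -
  interpret prob_space "Pr i"
    using assms by (simp add: markov_chain_def)
  have "hitting_time X b \<in> measurable (Pr i) (count_space UNIV)"
    using assms by (intro hitting_time_measurable) (simp add: markov_chain_def)
  then show ?thesis
    unfolding mean_hitting_time_def
    by (simp add: nn_integral_enat_function less_hitting_time_iff emeasure_eq_measure prob_avoid[OF assms])
qed

section \<open>Finiteness of the mean hitting times and their first-step equation\<close>

lemma hitting_equation_nonneg:
  fixes P :: "real ^ 'n ^ 'n" and g :: "'n \<Rightarrow> real"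
  assumes "stochastic P" and "g b = 0"
    and "\<And>i. i \<noteq> b \<Longrightarrow> g i = 1 + (\<Sum>j\<in>UNIV. P $ i $ j * g j)"
  shows "0 \<le> g i"
proof -
  have "Min (range g) \<in> range g"
    by (rule Min_in) auto
  then obtain k where "g k = Min (range g)"
    by (metis imageE)
  then have k: "g k \<le> g j" for j
    by simp
  \<comment> \<open>Minimum principle: off \<open>b\<close>, the value exceeds an average of values
    of \<open>g\<close> by one, so it cannot be minimal.\<close>
  have "k = b"
  proof (rule ccontr)
    assume "k \<noteq> b"
    have "g k = (\<Sum>j\<in>UNIV. P $ k $ j * g k)"
      using assms(1) by (simp add: stochastic_def sum_distrib_right[symmetric])
    also have "\<dots> \<le> (\<Sum>j\<in>UNIV. P $ k $ j * g j)"
      using assms(1) k by (intro sum_mono mult_left_mono) (auto simp: stochastic_def)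
    finally show False
      using assms(3)[OF \<open>k \<noteq> b\<close>] by simp
  qed
  with k[of i] assms(2) show ?thesis by simp
qed

text \<open>The partial sums obey the same first-step recursion started from zero, so a nonnegative
  solution dominates them by induction.\<close>

lemma survival_sum_bound:
  assumes "stochastic P" and "g b = 0" and "\<And>i. 0 \<le> g i"
    and "\<And>i. i \<noteq> b \<Longrightarrow> g i = 1 + (\<Sum>j\<in>UNIV. P $ i $ j * g j)"
  shows "(\<Sum>t<N. survival P b t i) \<le> g i"
proof (induction N arbitrary: i)
  case 0
  then show ?case using assms(3) by simp
next
  case (Suc N)
  show ?case
  proof (cases "i = b")
    case True
    then show ?thesis using assms(2) by simp
  next
    case False
    have "(\<Sum>t<Suc N. survival P b t i) = 1 + (\<Sum>j\<in>UNIV. P $ i $ j * (\<Sum>t<N. survival P b t j))"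
      unfolding sum.lessThan_Suc_shift using False by (simp add: sum_distrib_left sum.swap[of _ UNIV])
    also have "\<dots> \<le> 1 + (\<Sum>j\<in>UNIV. P $ i $ j * g j)"
      using assms(1) Suc.IH by (intro add_left_mono sum_mono mult_left_mono) (auto simp: stochastic_def)
    finally show ?thesis
      using assms(4)[OF False] by simp
  qed
qed

lemma hitting_equation_solution:
  assumes "stochastic P" and "ergodic P" and "equilibrium P w"
  obtains g :: "'n::finite \<Rightarrow> real" where "g b = 0"
    and "\<And>i. i \<noteq> b \<Longrightarrow> g i = 1 + (\<Sum>j\<in>UNIV. P $ i $ j * g j)"
proof -
  \<comment> \<open>Row \<open>i\<close> of the Laplacian carries the factor \<open>w $ i\<close>,
    so the constant 1 of the hitting equation becomes \<open>w $ i\<close>.\<close>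
  let ?r = "\<chi> i. if i = b then 0 else w $ i"
  obtain x where x: "\<And>i. i \<in> {b} \<Longrightarrow> x $ i = ?r $ i"
      "\<And>i. i \<notin> {b} \<Longrightarrow> (laplacian P w *v x) $ i = ?r $ i"
  proof (rule boundary_value_problem[of "{b}" "laplacian P w" ?r])
    fix x
    assume "\<And>i. i \<in> {b} \<Longrightarrow> x $ i = 0" "x \<bullet> (laplacian P w *v x) = 0"
    then show "x = 0"
      using laplace_form_pos[OF assms, of x b] by (auto simp: laplace_form_inner)
  qed (blast intro: that)
  show thesis
  proof (rule that[of "\<lambda>i. x $ i"])
    fix i assume "i \<noteq> b"
    then show "x $ i = 1 + (\<Sum>j\<in>UNIV. P $ i $ j * x $ j)"
      using x(2)[of i] equilibrium_pos[OF assms, of i] by (simp add: laplacian_mult_nth)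
  qed (use x(1) in simp)
qed

text \<open>An algebraic solution bounds the survival series and makes it summable; only then can
  the recursion be summed over time in the reals.\<close>

lemma mean_hitting_time_equation:
  fixes P :: "real ^ 'n ^ 'n"
  assumes "stochastic P" and "ergodic P" and "equilibrium P w" and "markov_chain P Pr X"
  obtains h :: "real ^ 'n" where "\<And>i. mean_hitting_time Pr X i b = ennreal (h $ i)"
    and "\<And>i. 0 \<le> h $ i" and "h $ b = 0"
    and "\<And>i. i \<noteq> b \<Longrightarrow> h $ i = 1 + (\<Sum>j\<in>UNIV. P $ i $ j * h $ j)"
proof -
  obtain g where g: "g b = 0" "\<And>i. i \<noteq> b \<Longrightarrow> g i = 1 + (\<Sum>j\<in>UNIV. P $ i $ j * g j)"
    using hitting_equation_solution[OF assms(1-3)] by blast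
  note nn = survival_nonneg[OF assms(1)]
  have sm: "summable (\<lambda>t. survival P b t i)" for i
  proof (rule bounded_imp_summable[OF nn])
    show "(\<Sum>k\<le>n. survival P b k i) \<le> g i" for n
      using survival_sum_bound[OF assms(1) g(1) hitting_equation_nonneg[OF assms(1) g] g(2)]
      by (metis lessThan_Suc_atMost)
  qed
  define h :: "real ^ 'n" where "h = (\<chi> i. \<Sum>t. survival P b t i)"
  show thesis
  proof (rule that[of h])
    show "mean_hitting_time Pr X i b = ennreal (h $ i)" for i
      by (simp add: mean_hitting_time_survival[OF assms(4)] suminf_ennreal2 nn sm h_def)
    show "0 \<le> h $ i" for i
      by (simp add: h_def suminf_nonneg sm nn)
    show "h $ b = 0"
      by (simp add: h_def)
    fix i assume i: "i \<noteq> b"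
    have "h $ i = survival P b 0 i + (\<Sum>t. survival P b (Suc t) i)"
      using suminf_split_head[OF sm[of i]] by (simp add: h_def)
    also have "(\<Sum>t. survival P b (Suc t) i) = (\<Sum>t. \<Sum>j\<in>UNIV. P $ i $ j * survival P b t j)"
      using i by simp
    also have "\<dots> = (\<Sum>j\<in>UNIV. P $ i $ j * h $ j)"
      by (simp add: suminf_sum summable_mult sm suminf_mult h_def)
    finally show "h $ i = 1 + (\<Sum>j\<in>UNIV. P $ i $ j * h $ j)"
      using i by simp
  qed
qed

text \<open>Off \<open>b\<close> this is the hitting equation times \<open>w $ i\<close>; the entry
  at \<open>b\<close> follows because all entries sum to zero while \<open>w\<close> sums to
  one.\<close>

lemma laplacian_hitting:
  fixes h :: "real ^ 'n"
  assumes "equilibrium P w" and "\<And>i. i \<noteq> b \<Longrightarrow> h $ i = 1 + (\<Sum>j\<in>UNIV. P $ i $ j * h $ j)"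
  shows "laplacian P w *v h = w - axis b 1"
proof -
  have off: "(laplacian P w *v h) $ i = w $ i" if "i \<noteq> b" for i
    using assms(2)[OF that] by (simp add: laplacian_mult_nth)
  have "(laplacian P w *v h) $ b + (\<Sum>i\<in>UNIV - {b}. w $ i) = (\<Sum>i\<in>UNIV. (laplacian P w *v h) $ i)"
    using off by (simp add: sum.remove[of UNIV b])
  also have "\<dots> = (\<Sum>i\<in>UNIV. w $ i) - 1"
    using sum_laplacian_mult[OF assms(1)] assms(1) by (simp add: equilibrium_def)
  also have "\<dots> = w $ b + (\<Sum>i\<in>UNIV - {b}. w $ i) - 1"
    by (simp add: sum.remove[of UNIV b])
  finally show ?thesis
    using off by (auto simp: vec_eq_iff axis_def)
qed

lemma laplacian_const:
  assumes "stochastic P"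
  shows "laplacian P w *v vec c = 0"
  using assms by (simp add: vec_eq_iff laplacian_mult_nth stochastic_def sum_distrib_right[symmetric])

theorem mainTheorem2:
  fixes P :: "real ^ 'n ^ 'n" and w :: "real ^ 'n"
    and Pr :: "'n \<Rightarrow> 'w measure" and X :: "nat \<Rightarrow> 'w \<Rightarrow> 'n"
    and a b :: 'n
  assumes "stochastic P" and "ergodic P" and "equilibrium P w"
    and "markov_chain P Pr X"
    and "a \<noteq> b"
  shows "commuting_time Pr X a b < \<infinity> \<and>
    (\<exists>F :: real ^ 'n \<Rightarrow> real.
       (\<forall>\<alpha>\<in>potentials a b.
          is_maximum {laplace_form P w \<phi> \<psi> |\<phi> \<psi>.
              \<phi> \<in> potentials a b \<and> \<psi> \<in> potentials a b \<and> \<phi> + \<psi> = 2 *\<^sub>R \<alpha>} (F \<alpha>)) \<and>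
       is_minimum (F ` potentials a b) (1 / enn2real (commuting_time Pr X a b)))"
proof -
  obtain h where h: "\<And>i. mean_hitting_time Pr X i b = ennreal (h $ i)" "\<And>i. 0 \<le> h $ i" "h $ b = 0"
      "\<And>i. i \<noteq> b \<Longrightarrow> h $ i = 1 + (\<Sum>j\<in>UNIV. P $ i $ j * h $ j)"
    using mean_hitting_time_equation[OF assms(1-4), of b] by blast
  obtain k where k: "\<And>i. mean_hitting_time Pr X i a = ennreal (k $ i)" "\<And>i. 0 \<le> k $ i" "k $ a = 0"
      "\<And>i. i \<noteq> a \<Longrightarrow> k $ i = 1 + (\<Sum>j\<in>UNIV. P $ i $ j * k $ j)"
    using mean_hitting_time_equation[OF assms(1-4), of a] by blast
  define T where "T = h $ a + k $ b"
  have T: "commuting_time Pr X a b = ennreal T"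
    unfolding commuting_time_def h k T_def by (rule ennreal_plus[symmetric]) (rule h k)+
  have "1 \<le> h $ a"
    using assms(1) h(2) by (subst h(4)[OF \<open>a \<noteq> b\<close>]) (auto simp: stochastic_def intro!: sum_nonneg)
  then have "0 < T"
    using k(2)[of b] by (simp add: T_def)
  \<comment> \<open>The constant makes \<psi> vanish at \<open>b\<close>; dividing by
    \<open>T\<close> makes it 1 at \<open>a\<close>.\<close>
  define \<psi> where "\<psi> = (1 / T) *\<^sub>R (h - k + vec (k $ b))"
  have "\<psi> \<in> potentials a b"
    using \<open>0 < T\<close> h(3) k(3) by (simp add: \<psi>_def potentials_def T_def)
  \<comment> \<open>The two copies of \<open>w\<close> cancel, leaving a unit source at
    \<open>a\<close> and sink at \<open>b\<close>, scaled by \<open>1 / T\<close>. Pairing with a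
    potential then sees only its boundary values.\<close>
  have "laplacian P w *v \<psi> = (1 / T) *\<^sub>R (axis a 1 - axis b 1)"
    unfolding \<psi>_def
    by (simp add: matrix_vector_mult_scaleR matrix_vector_right_distrib matrix_vector_mult_diff_distrib
        laplacian_const[OF assms(1)] laplacian_hitting[OF assms(3) h(4)] laplacian_hitting[OF assms(3) k(4)])
  then have val: "\<phi> \<bullet> (laplacian P w *v \<psi>) = 1 / T" if "\<phi> \<in> potentials a b" for \<phi>
    using that by (simp add: inner_diff_right inner_axis potentials_def)
  have "\<exists>F. (\<forall>\<alpha>\<in>potentials a b. is_maximum (splittings (laplacian P w) a b \<alpha>) (F \<alpha>)) \<and>
      is_minimum (F ` potentials a b) (1 / T)"
  proof (rule splittings_minimax[OF _ \<open>a \<noteq> b\<close> \<open>\<psi> \<in> potentials a b\<close> val])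
    show "0 < x \<bullet> (laplacian P w *v x)" if "x $ a = 0" "x $ b = 0" "x \<noteq> 0" for x
      using laplace_form_pos[OF assms(1-3) that(2,3)] by (simp add: laplace_form_inner)
  qed
  then show ?thesis
    using \<open>0 < T\<close> unfolding T splittings_def laplace_form_inner by simp
qed

end
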